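(* Let $d$ be a positive integer and let $M$ be a real $d\times d$ matrix. Let $U$, $S$, $V$ be real $d\times d$ matrices such that $M=USV^T$ is a singular value decomposition of $M$. If $\det(UV^T)>0$, then $R=UV^T$ maximizes $\mathrm{tr}(RM^T)$ over all $d\times d$ rotation matrices $R$. Otherwise, if $\det(UV^T)<0$, then with $\tilde{S}=\mathrm{diag}\{s_1,\ldots,s_d\}$, $s_1=\cdots=s_{d-1}=1$, $s_d=-1$, the matrix $R=U\tilde{S}V^T$ maximizes $\mathrm{tr}(RM^T)$ over all $d\times d$ rotation matrices $R$.
   Context: All matrices are real. A $d\times d$ rotation matrix is a $d\times d$ orthogonal matrix of determinant $1$ (for $d=1$ the only one is $1$). A singular value decomposition of a $d\times d$ matrix $M$ is a representation $M=USV^T$ where $U$ and $V$ are $d\times d$ orthogonal matrices and $S=\mathrm{diag}\{\sigma_1,\ldots,\sigma_d\}$ is the diagonal matrix of the singular values of $M$ in descending order, $\sigma_1\ge\sigma_2\ge\cdots\ge\sigma_d\ge 0$. Here $\mathrm{diag}\{s_1,\ldots,s_d\}$ is the diagonal matrix with diagonal entries $s_1,\ldots,s_d$ in that order from the upper left to the lower right, and $\mathrm{tr}$ is the trace. "Maximizes over all rotation matrices" means the displayed matrix is itself a rotation matrix and attains the maximum value of $\mathrm{tr}(RM^T)$ among rotation matrices $R$. *)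

theory Defs
  imports "HOL-Analysis.Analysis"
begin

text \<open>
  Rows and columns are indexed by a finite linearly ordered type, whose elements in increasing
  order play the role of \<open>1, \<dots>, d\<close> with \<open>d = CARD('n)\<close>; the last index is \<open>Max UNIV\<close>.
\<close>

definition diag_matrix :: "('n \<Rightarrow> real) \<Rightarrow> real^'n^'n" where
  "diag_matrix s = (\<chi> i j. if i = j then s i else 0)"

text \<open>
  The singular values of \<open>M\<close> are the square roots of the eigenvalues of \<open>M\<^sup>T M\<close>, counted with
  multiplicity; multiplicities are read off the characteristic polynomial.
\<close>

definition descending_singular_values ::
    "real^'n::{finite,linorder}^'n::{finite,linorder} \<Rightarrow> ('n::{finite,linorder} \<Rightarrow> real) \<Rightarrow> bool" where
  "descending_singular_values M \<sigma> \<longleftrightarrow>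
     antimono \<sigma> \<and> (\<forall>i. 0 \<le> \<sigma> i) \<and>
     (\<forall>x. det (mat x - transpose M ** M) = (\<Prod>i\<in>UNIV. x - (\<sigma> i)\<^sup>2))"

definition is_svd ::
    "real^'n::{finite,linorder}^'n::{finite,linorder} \<Rightarrow>
     real^'n::{finite,linorder}^'n::{finite,linorder} \<Rightarrow>
     real^'n::{finite,linorder}^'n::{finite,linorder} \<Rightarrow>
     real^'n::{finite,linorder}^'n::{finite,linorder} \<Rightarrow> bool" where
  "is_svd M U S V \<longleftrightarrow>
     orthogonal_matrix U \<and> orthogonal_matrix V \<and>
     (\<exists>\<sigma>. descending_singular_values M \<sigma> \<and> S = diag_matrix \<sigma>) \<and>
     M = U ** S ** transpose V"

text \<open>
  The characteristic polynomial condition is implied by the factorization, so \<open>is_svd\<close> agrees with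
  the definition that only asks for descending nonnegative diagonal entries.
\<close>

lemma is_svd_iff:
  "is_svd M U S V \<longleftrightarrow>
     orthogonal_matrix U \<and> orthogonal_matrix V \<and>
     (\<exists>\<sigma>. antimono \<sigma> \<and> (\<forall>i. 0 \<le> \<sigma> i) \<and> S = diag_matrix \<sigma>) \<and>
     M = U ** S ** transpose V"
proof -
  have "det (mat x - transpose M ** M) = (\<Prod>i\<in>UNIV. x - (\<sigma> i)\<^sup>2)"
    if U: "orthogonal_matrix U" and V: "orthogonal_matrix V"
      and M: "M = U ** diag_matrix \<sigma> ** transpose V" for \<sigma> :: "'a \<Rightarrow> real" and x
  proof -
    let ?D = "diag_matrix \<sigma>" and ?E = "diag_matrix (\<lambda>i. x - (\<sigma> i)\<^sup>2)"
    have D: "transpose ?D = ?D"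
      by (auto simp: transpose_def diag_matrix_def vec_eq_iff)
    have E: "mat x - ?D ** ?D = ?E"
    proof -
      have "(\<Sum>k\<in>UNIV. ?D $ i $ k * ?D $ k $ j) = (if i = j then (\<sigma> i)\<^sup>2 else 0)" for i j
      proof -
        have "(\<Sum>k\<in>UNIV. ?D $ i $ k * ?D $ k $ j) =
              (\<Sum>k\<in>UNIV. if i = k then \<sigma> i * ?D $ i $ j else 0)"
          by (rule sum.cong) (auto simp: diag_matrix_def)
        then show ?thesis
          by (simp add: diag_matrix_def power2_eq_square)
      qed
      then show ?thesis
        by (simp add: matrix_matrix_mult_def vec_eq_iff) (simp add: mat_def diag_matrix_def)
    qed
    have VV: "V ** transpose V = mat 1"
      using V by (simp add: orthogonal_matrix_def)
    have "transpose M ** M = V ** ?D ** (transpose U ** U) ** ?D ** transpose V"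
      by (simp add: M matrix_transpose_mul D matrix_mul_assoc)
    also have "\<dots> = V ** (?D ** ?D) ** transpose V"
      using U by (simp add: orthogonal_matrix_def matrix_mul_assoc)
    finally have MM: "transpose M ** M = V ** (?D ** ?D) ** transpose V" .
    have x: "mat x = x *\<^sub>R (V ** transpose V)"
      by (simp add: VV mat_def vec_eq_iff)
    have mat: "V ** mat x ** transpose V = mat x"
      by (simp add: x VV matrix_scalar_ac flip: scalar_matrix_assoc)
    have "V ** (mat x - ?D ** ?D) = V ** mat x - V ** (?D ** ?D)"
      by (simp add: matrix_matrix_mult_def vec_eq_iff right_diff_distrib sum_subtractf)
    moreover have "(V ** mat x - V ** (?D ** ?D)) ** transpose V =
        V ** mat x ** transpose V - V ** (?D ** ?D) ** transpose V"
      by (simp add: matrix_matrix_mult_def vec_eq_iff left_diff_distrib sum_subtractf)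
    ultimately have "mat x - transpose M ** M = V ** ?E ** transpose V"
      by (simp add: MM mat flip: E)
    then have "det (mat x - transpose M ** M) = det (V ** transpose V) * det ?E"
      by (simp add: det_mul)
    then show ?thesis
      by (simp add: VV, subst det_diagonal) (auto simp: diag_matrix_def)
  qed
  then show ?thesis
    unfolding is_svd_def descending_singular_values_def by blast
qed

end

theory Submission imports Defs begin

text \<open>
  Substituting \<open>R = U W V\<^sup>T\<close> turns \<open>tr (R M\<^sup>T)\<close> into \<open>\<Sum>i. W\<^sub>i\<^sub>i \<sigma>\<^sub>i\<close> with \<open>W\<close> orthogonal and
  \<open>det W = det (U V\<^sup>T)\<close>. Entries of an orthogonal matrix are at most 1, which settles the case of
  determinant 1. If \<open>det W = -1\<close>, then \<open>-1\<close> is an eigenvalue of \<open>W\<close>; flipping the sign of \<open>W\<close> on a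
  unit eigenvector gives an orthogonal matrix of trace \<open>tr W + 2\<close>, so \<open>tr W \<le> d - 2\<close>. Now split
  \<open>\<sigma>\<^sub>i = \<sigma>\<^sub>d + (\<sigma>\<^sub>i - \<sigma>\<^sub>d)\<close>, bounding the first part by the trace and the second one entrywise.
\<close>

text \<open>The rows are unit vectors, and a coordinate never exceeds the norm.\<close>

lemma orthogonal_matrix_entry_le_1:
  fixes A :: "real^'n^'n"
  assumes "orthogonal_matrix A"
  shows "A $ i $ j \<le> 1"
proof -
  have "norm (row i A) = 1"
    using assms by (simp add: orthogonal_matrix_orthonormal_rows)
  then show ?thesis
    using component_le_norm_cart[of "row i A" j] by (simp add: row_def)
qed

lemma orthogonal_matrix_trace_le:
  fixes A :: "real^'n^'n"
  assumes "orthogonal_matrix A"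
  shows "trace A \<le> real CARD('n)"
  using sum_bounded_above[of UNIV "\<lambda>i. A $ i $ i" 1] orthogonal_matrix_entry_le_1[OF assms]
  by (simp add: trace_def)

text \<open>From \<open>A ** transpose A = mat 1\<close> follows
  \<open>mat 1 + A = A ** transpose (mat 1 + A)\<close>. Taking determinants gives
  \<open>det (mat 1 + A) = - det (mat 1 + A)\<close>, so \<open>mat 1 + A\<close> is singular, and
  any nonzero kernel vector can be normalized.\<close>

lemma orthogonal_matrix_det_neg_eigenvector:
  fixes A :: "real^'n^'n"
  assumes A: "orthogonal_matrix A" and det: "det A = - 1"
  obtains v where "norm v = 1" "A *v v = - v"
proof -
  have "transpose (mat 1 + A) = mat 1 + transpose A"
    by (simp add: transpose_def mat_def vec_eq_iff)
  then have "mat 1 + A = A ** transpose (mat 1 + A)"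
    using A by (simp add: orthogonal_matrix_def matrix_add_ldistrib)
  then have "det (mat 1 + A) = det A * det (mat 1 + A)"
    by (metis det_mul det_transpose)
  then have "det (mat 1 + A) = 0"
    using det by simp
  then have "\<not> invertible (mat 1 + A)"
    by (simp add: invertible_det_nz)
  then obtain w where w: "w \<noteq> 0" "(mat 1 + A) *v w = 0"
    by (metis invertible_left_inverse matrix_left_invertible_ker)
  then have "A *v w = - w"
    by (simp add: matrix_vector_mult_add_rdistrib add_eq_0_iff)
  then have "A *v (w /\<^sub>R norm w) = - (w /\<^sub>R norm w)"
    by (simp add: matrix_vector_mult_scaleR)
  moreover have "norm (w /\<^sub>R norm w) = 1"
    using w by simp
  ultimately show ?thesis
    using that by blast
qed

lemma orthogonal_matrix_det_neg_trace_le: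
  fixes A :: "real^'n^'n"
  assumes A: "orthogonal_matrix A" and det: "det A = - 1"
  shows "trace A \<le> real CARD('n) - 2"
proof -
  obtain v where v: "norm v = 1" "A *v v = - v"
    using orthogonal_matrix_det_neg_eigenvector[OF A det] .
  have A_orth: "orthogonal_transformation ((*v) A)"
    using A by (simp add: orthogonal_transformation_matrix)
  \<comment> \<open>This is A + 2 v v^T: it agrees with \<open>A\<close> on the orthogonal
    complement of \<open>v\<close> and fixes \<open>v\<close>, which \<open>A\<close>
    negates.\<close>
  define B where "B = A + (\<chi> i j. 2 * v $ i * v $ j)"
  have B: "B *v x = A *v x + (2 * (v \<bullet> x)) *\<^sub>R v" for x
    by (simp add: B_def matrix_vector_mult_def vec_eq_iff inner_vec_def distrib_left distrib_right
        sum.distrib sum_distrib_left sum_distrib_right mult_ac)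
  have "norm (B *v x) = norm x" for x
  proof -
    have "(A *v v) \<bullet> (A *v x) = v \<bullet> x" and Ax: "(A *v x) \<bullet> (A *v x) = x \<bullet> x"
      using A_orth by (simp_all add: orthogonal_transformation_def)
    \<comment> \<open>In the expansion of the squared norm of \<open>B *v x\<close>, this turns the
      cross term into -4 (v \<bullet> x)^2, which cancels the square of the added multiple of
      \<open>v\<close>.\<close>
    then have "v \<bullet> (A *v x) = - (v \<bullet> x)"
      using v by simp
    then have "(B *v x) \<bullet> (B *v x) = x \<bullet> x"
      using Ax v(1) by (simp add: B inner_add_left inner_add_right inner_commute norm_eq_1 algebra_simps)
    then show ?thesis
      by (simp add: norm_eq)
  qed
  then have "orthogonal_transformation ((*v) B)"
    by (simp add: orthogonal_transformation)
  then have "orthogonal_matrix B"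
    by (simp add: orthogonal_transformation_matrix)
  then have "trace B \<le> real CARD('n)"
    by (rule orthogonal_matrix_trace_le)
  moreover have "trace B = trace A + 2 * (v \<bullet> v)"
    by (simp add: B_def trace_def sum.distrib inner_vec_def sum_distrib_left mult_ac)
  ultimately show ?thesis
    using v by (simp add: norm_eq_1)
qed

lemma transpose_diag_matrix: "transpose (diag_matrix s) = diag_matrix s"
  by (auto simp: transpose_def diag_matrix_def vec_eq_iff)

lemma diag_matrix_mult: "diag_matrix s ** diag_matrix t = diag_matrix (\<lambda>i. s i * t i)"
proof -
  have "(\<Sum>k\<in>UNIV. diag_matrix s $ i $ k * diag_matrix t $ k $ j) =
      (\<Sum>k\<in>UNIV. if i = k then s i * diag_matrix t $ i $ j else 0)" for i j
    by (rule sum.cong) (auto simp: diag_matrix_def)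
  then show ?thesis
    by (auto simp: matrix_matrix_mult_def vec_eq_iff) (auto simp: diag_matrix_def)
qed

lemma orthogonal_matrix_diag_matrix:
  assumes "\<And>i. s i * s i = 1"
  shows "orthogonal_matrix (diag_matrix s)"
  using assms by (simp add: orthogonal_matrix_def transpose_diag_matrix diag_matrix_mult)
    (simp add: diag_matrix_def mat_def)

lemma trace_mult_diag_matrix:
  "trace (A ** diag_matrix s) = (\<Sum>i\<in>UNIV. A $ i $ i * s i)"
  by (simp add: trace_def matrix_matrix_mult_def diag_matrix_def if_distrib cong: if_cong)

text \<open>The inner factor \<open>transpose V ** V\<close> cancels directly; cyclicity of the
  trace then moves the leading \<open>U\<close> next to \<open>transpose U\<close>, where both
  cancel.\<close>

lemma trace_conj_orthogonal:
  fixes U V Q :: "real^'n^'n"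
  assumes U: "orthogonal_matrix U" and V: "orthogonal_matrix V"
  shows "trace ((U ** Q ** transpose V) ** transpose (U ** diag_matrix s ** transpose V)) =
    (\<Sum>i\<in>UNIV. Q $ i $ i * s i)"
proof -
  have "(U ** Q ** transpose V) ** transpose (U ** diag_matrix s ** transpose V) =
      U ** Q ** (transpose V ** V) ** diag_matrix s ** transpose U"
    by (simp add: matrix_transpose_mul transpose_diag_matrix matrix_mul_assoc)
  also have "\<dots> = U ** (Q ** diag_matrix s ** transpose U)"
    using V by (simp add: orthogonal_matrix_def matrix_mul_assoc)
  finally have "trace ((U ** Q ** transpose V) ** transpose (U ** diag_matrix s ** transpose V)) =
      trace (Q ** diag_matrix s ** (transpose U ** U))"
    by (metis trace_mul_sym matrix_mul_assoc)
  then show ?thesis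
    using U by (simp add: orthogonal_matrix_def trace_mult_diag_matrix)
qed

lemma orthogonal_matrix_diag_sum_le:
  fixes A :: "real^'n^'n"
  assumes "orthogonal_matrix A" and "\<And>i. 0 \<le> s i"
  shows "(\<Sum>i\<in>UNIV. A $ i $ i * s i) \<le> (\<Sum>i\<in>UNIV. s i)"
  using mult_right_mono[OF orthogonal_matrix_entry_le_1] assms by (fastforce intro: sum_mono)

lemma orthogonal_matrix_det_neg_diag_sum_le:
  fixes A :: "real^'n^'n"
  assumes A: "orthogonal_matrix A" "det A = - 1" and s: "0 \<le> s k" "\<And>i. s k \<le> s i"
  shows "(\<Sum>i\<in>UNIV. A $ i $ i * s i) \<le> (\<Sum>i\<in>UNIV. s i) - 2 * s k"
proof -
  have "(\<Sum>i\<in>UNIV. A $ i $ i * s i) = s k * trace A + (\<Sum>i\<in>UNIV. A $ i $ i * (s i - s k))"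
    by (simp add: trace_def sum_distrib_left algebra_simps flip: sum.distrib)
  \<comment> \<open>Both bounds need nonnegative weights: \<open>s k\<close> for the trace bound,
    and \<open>s i - s k\<close> for the entrywise bound, the latter because \<open>s k\<close> is
    minimal.\<close>
  also have "\<dots> \<le> s k * (real CARD('n) - 2) + (\<Sum>i\<in>UNIV. s i - s k)"
    using A s by (intro add_mono mult_left_mono orthogonal_matrix_det_neg_trace_le
        orthogonal_matrix_diag_sum_le) auto
  also have "\<dots> = (\<Sum>i\<in>UNIV. s i) - 2 * s k"
    by (simp add: sum_subtractf algebra_simps)
  finally show ?thesis .
qed

text \<open>Both cases reduce to this: W \<mapsto> U W V^T maps the orthogonal matrices with the
  determinant of U V^T bijectively onto the rotations, so it suffices to maximize the weighted
  diagonal sum over such \<open>W\<close>.\<close>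

lemma is_arg_max_rotation_matrix:
  fixes U V Q :: "real^'n^'n"
  assumes U: "orthogonal_matrix U" and V: "orthogonal_matrix V"
    and Q: "orthogonal_matrix Q" "det Q = det (U ** transpose V)"
    and max: "\<And>W. orthogonal_matrix W \<Longrightarrow> det W = det (U ** transpose V) \<Longrightarrow>
      (\<Sum>i\<in>UNIV. W $ i $ i * s i) \<le> (\<Sum>i\<in>UNIV. Q $ i $ i * s i)"
  shows "is_arg_max (\<lambda>R. trace (R ** transpose (U ** diag_matrix s ** transpose V)))
    rotation_matrix (U ** Q ** transpose V)"
proof -
  \<comment> \<open>These make det (U Q V^T) = (det U)^2 (det V)^2 = 1.\<close>
  have det_sq: "det U * det U = 1" "det V * det V = 1"
    using det_orthogonal_matrix[OF U] det_orthogonal_matrix[OF V] by auto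
  have "rotation_matrix (U ** Q ** transpose V)"
    using U V Q det_sq by (auto simp: rotation_matrix_def orthogonal_matrix_mul
        orthogonal_matrix_transpose det_mul algebra_simps)
  moreover have "trace (R ** transpose (U ** diag_matrix s ** transpose V))
      \<le> trace ((U ** Q ** transpose V) ** transpose (U ** diag_matrix s ** transpose V))"
    if R: "rotation_matrix R" for R
  proof -
    \<comment> \<open>The preimage of \<open>R\<close> under the substitution.\<close>
    define W where "W = transpose U ** R ** V"
    have "U ** W ** transpose V = (U ** transpose U) ** R ** (V ** transpose V)"
      by (simp add: W_def matrix_mul_assoc)
    then have RW: "R = U ** W ** transpose V"
      using U V by (simp add: orthogonal_matrix_def)
    have "orthogonal_matrix W" "det W = det (U ** transpose V)"
      using R U V by (simp_all add: W_def rotation_matrix_def orthogonal_matrix_mul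
          orthogonal_matrix_transpose det_mul)
    then show ?thesis
      using max unfolding RW trace_conj_orthogonal[OF U V] by blast
  qed
  ultimately show ?thesis
    by (auto simp: is_arg_max_def not_less)
qed

theorem mainTheorem1:
  fixes M U S V :: "real^'n::{finite,linorder}^'n::{finite,linorder}"
  assumes "is_svd M U S V"
  shows "(det (U ** transpose V) > 0 \<longrightarrow>
           is_arg_max (\<lambda>R. trace (R ** transpose M)) rotation_matrix (U ** transpose V)) \<and>
         (det (U ** transpose V) < 0 \<longrightarrow>
           is_arg_max (\<lambda>R. trace (R ** transpose M)) rotation_matrix
             (U ** diag_matrix (\<lambda>i. if i = Max UNIV then - 1 else 1) ** transpose V))"
proof -
  obtain \<sigma> where U: "orthogonal_matrix U" and V: "orthogonal_matrix V"
    and \<sigma>: "antimono \<sigma>" "\<And>i. 0 \<le> \<sigma> i" and M: "M = U ** diag_matrix \<sigma> ** transpose V"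
    using assms unfolding is_svd_iff by blast
  have "orthogonal_matrix (U ** transpose V)"
    using U V by (simp add: orthogonal_matrix_mul orthogonal_matrix_transpose)
  then have det: "det (U ** transpose V) = 1 \<or> det (U ** transpose V) = - 1"
    by (rule det_orthogonal_matrix)
  show ?thesis
  proof (intro conjI impI)
    assume pos: "det (U ** transpose V) > 0"
    have mat_1_diag: "(mat 1 :: real^'n::{finite,linorder}^'n::{finite,linorder}) $ i $ i = 1" for i
      by (simp add: mat_def)
    \<comment> \<open>The identity has the required determinant 1 and attains the entrywise
      bound.\<close>
    have "is_arg_max (\<lambda>R. trace (R ** transpose M)) rotation_matrix (U ** mat 1 ** transpose V)"
      unfolding M using pos det U V \<sigma> orthogonal_matrix_diag_sum_le[of _ \<sigma>]
      by (intro is_arg_max_rotation_matrix) (auto simp: orthogonal_matrix_id mat_1_diag)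
    then show "is_arg_max (\<lambda>R. trace (R ** transpose M)) rotation_matrix (U ** transpose V)"
      by simp
  next
    assume neg: "det (U ** transpose V) < 0"
    define k :: 'n where "k = Max UNIV"
    define D :: "real^'n::{finite,linorder}^'n::{finite,linorder}" where "D = diag_matrix (\<lambda>i. if i = k then - 1 else 1)"
    have D_orth: "orthogonal_matrix D"
      unfolding D_def by (rule orthogonal_matrix_diag_matrix) simp
    have "det D = (\<Prod>i\<in>UNIV. D $ i $ i)"
      by (rule det_diagonal) (simp add: D_def diag_matrix_def)
    then have D_det: "det D = - 1"
      by (simp add: D_def diag_matrix_def)
    have "(\<Sum>i\<in>UNIV. D $ i $ i * \<sigma> i) = (\<Sum>i\<in>UNIV. \<sigma> i - (if i = k then 2 * \<sigma> i else 0))"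
      by (rule sum.cong) (auto simp: D_def diag_matrix_def)
    \<comment> \<open>Exactly the upper bound for determinant -1, so \<open>D\<close> attains
      it.\<close>
    then have D_sum: "(\<Sum>i\<in>UNIV. D $ i $ i * \<sigma> i) = (\<Sum>i\<in>UNIV. \<sigma> i) - 2 * \<sigma> k"
      by (simp add: sum_subtractf)
    \<comment> \<open>The descending order puts the smallest singular value at the last index, which
      is why the sign is flipped there.\<close>
    have "\<sigma> k \<le> \<sigma> i" for i
      using \<sigma>(1) by (simp add: k_def antimonoD)
    then show "is_arg_max (\<lambda>R. trace (R ** transpose M)) rotation_matrix
        (U ** diag_matrix (\<lambda>i. if i = Max UNIV then - 1 else 1) ** transpose V)"
      unfolding M k_def[symmetric] D_def[symmetric]
      using det neg U V \<sigma> D_orth D_det orthogonal_matrix_det_neg_diag_sum_le[of _ \<sigma> k]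
      by (intro is_arg_max_rotation_matrix) (auto simp: D_sum)
  qed
qed

end
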